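(* Let $(T,+,\Gamma)$ be a commutative ternary $\Gamma$-semiring. The mapping $I\mapsto\sqrt{I}$ is a closure operator on the lattice of ideals of $T$, and the fixed points of this operator are precisely the semiprime ideals of $T$.
   Context: A ternary $\Gamma$-semiring $(T,+,\Gamma)$ consists of a set $T$, an addition $+$, a set $\Gamma$ of parameters, and a map $T\times\Gamma\times T\times\Gamma\times T\to T$, $(a,\alpha,b,\beta,c)\mapsto a_{\alpha}b_{\beta}c$, such that: $(T,+)$ is a commutative semigroup with identity element $0$; $(a_{\alpha}b_{\beta}c)_{\gamma}d_{\delta}e=a_{\alpha}b_{\beta}(c_{\gamma}d_{\delta}e)$; the product is additive in each of its three $T$-variables; and $0_{\alpha}b_{\beta}c=a_{\alpha}0_{\beta}c=a_{\alpha}b_{\beta}0=0$. It is commutative if $a_{\alpha}b_{\beta}c=b_{\beta}a_{\alpha}c=c_{\alpha}b_{\beta}a$ for all $a,b,c\in T$, $\alpha,\beta\in\Gamma$. An ideal is a nonempty $I\subseteq T$ closed under $+$ such that $a_{\alpha}b_{\beta}c\in I$ whenever at least one of $a,b,c\in T$ lies in $I$ (all $\alpha,\beta\in\Gamma$). An ideal $P\ne T$ is prime if for all $a,b,c\in T$, $\alpha,\beta\in\Gamma$: $a_{\alpha}b_{\beta}c\in P$ implies $a\in P$ or $b\in P$ or $c\in P$. An ideal $Q\neq T$ is semiprime if for all $a\in T$, $\alpha,\beta\in\Gamma$: $a_{\alpha}a_{\beta}a\in Q$ implies $a\in Q$. The (prime) radical of an ideal $I$ is $\sqrt{I}=\bigcap\{P\mid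 P\text{ a prime ideal of }T,\ I\subseteq P\}$.
   Formalization: The fixed points are stated to be the semiprime ideals together with T itself: T is an ideal with √T = T (empty intersection), but semiprime ideals are required to be proper, so the literal claim fails at T. *)

theory Defs
  imports "HOL-Algebra.Group"
begin

record ('a, 'g) ternary_gamma = "'a partial_object" +
  tplus :: "'a \<Rightarrow> 'a \<Rightarrow> 'a"  (infixl \<open>\<boxplus>\<index>\<close> 65)
  tzero :: 'a  (\<open>\<zero>\<index>\<close>)
  params :: "'g set"
  tprod :: "'a \<Rightarrow> 'g \<Rightarrow> 'a \<Rightarrow> 'g \<Rightarrow> 'a \<Rightarrow> 'a"

locale ternary_gamma_semiring =
  fixes T :: "('a, 'g, 'm) ternary_gamma_scheme" (structure)
  assumes tplus_comm_monoid: "comm_monoid \<lparr>carrier = carrier T, mult = tplus T, one = tzero T\<rparr>"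
    and tprod_closed: "\<lbrakk>a \<in> carrier T; b \<in> carrier T; c \<in> carrier T; \<alpha> \<in> params T; \<beta> \<in> params T\<rbrakk>
      \<Longrightarrow> tprod T a \<alpha> b \<beta> c \<in> carrier T"
    and tprod_assoc: "\<lbrakk>a \<in> carrier T; b \<in> carrier T; c \<in> carrier T; d \<in> carrier T; e \<in> carrier T;
        \<alpha> \<in> params T; \<beta> \<in> params T; \<gamma> \<in> params T; \<delta> \<in> params T\<rbrakk>
      \<Longrightarrow> tprod T (tprod T a \<alpha> b \<beta> c) \<gamma> d \<delta> e = tprod T a \<alpha> b \<beta> (tprod T c \<gamma> d \<delta> e)"
    and tprod_add_left: "\<lbrakk>a \<in> carrier T; a' \<in> carrier T; b \<in> carrier T; c \<in> carrier T;
        \<alpha> \<in> params T; \<beta> \<in> params T\<rbrakk>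
      \<Longrightarrow> tprod T (a \<boxplus> a') \<alpha> b \<beta> c = tprod T a \<alpha> b \<beta> c \<boxplus> tprod T a' \<alpha> b \<beta> c"
    and tprod_add_mid: "\<lbrakk>a \<in> carrier T; b \<in> carrier T; b' \<in> carrier T; c \<in> carrier T;
        \<alpha> \<in> params T; \<beta> \<in> params T\<rbrakk>
      \<Longrightarrow> tprod T a \<alpha> (b \<boxplus> b') \<beta> c = tprod T a \<alpha> b \<beta> c \<boxplus> tprod T a \<alpha> b' \<beta> c"
    and tprod_add_right: "\<lbrakk>a \<in> carrier T; b \<in> carrier T; c \<in> carrier T; c' \<in> carrier T;
        \<alpha> \<in> params T; \<beta> \<in> params T\<rbrakk>
      \<Longrightarrow> tprod T a \<alpha> b \<beta> (c \<boxplus> c') = tprod T a \<alpha> b \<beta> c \<boxplus> tprod T a \<alpha> b \<beta> c'"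
    and tprod_zero_left: "\<lbrakk>b \<in> carrier T; c \<in> carrier T; \<alpha> \<in> params T; \<beta> \<in> params T\<rbrakk>
      \<Longrightarrow> tprod T \<zero> \<alpha> b \<beta> c = \<zero>"
    and tprod_zero_mid: "\<lbrakk>a \<in> carrier T; c \<in> carrier T; \<alpha> \<in> params T; \<beta> \<in> params T\<rbrakk>
      \<Longrightarrow> tprod T a \<alpha> \<zero> \<beta> c = \<zero>"
    and tprod_zero_right: "\<lbrakk>a \<in> carrier T; b \<in> carrier T; \<alpha> \<in> params T; \<beta> \<in> params T\<rbrakk>
      \<Longrightarrow> tprod T a \<alpha> b \<beta> \<zero> = \<zero>"

locale comm_ternary_gamma_semiring = ternary_gamma_semiring +
  assumes tprod_comm_12: "\<lbrakk>a \<in> carrier T; b \<in> carrier T; c \<in> carrier T; \<alpha> \<in> params T; \<beta> \<in> params T\<rbrakk>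
      \<Longrightarrow> tprod T a \<alpha> b \<beta> c = tprod T b \<beta> a \<alpha> c"
    and tprod_comm_13: "\<lbrakk>a \<in> carrier T; b \<in> carrier T; c \<in> carrier T; \<alpha> \<in> params T; \<beta> \<in> params T\<rbrakk>
      \<Longrightarrow> tprod T a \<alpha> b \<beta> c = tprod T c \<alpha> b \<beta> a"

definition tg_ideal :: "('a, 'g, 'm) ternary_gamma_scheme \<Rightarrow> 'a set \<Rightarrow> bool" where
  "tg_ideal T I \<longleftrightarrow> I \<noteq> {} \<and> I \<subseteq> carrier T \<and>
     (\<forall>x\<in>I. \<forall>y\<in>I. tplus T x y \<in> I) \<and>
     (\<forall>a\<in>carrier T. \<forall>b\<in>carrier T. \<forall>c\<in>carrier T. \<forall>\<alpha>\<in>params T. \<forall>\<beta>\<in>params T.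
        a \<in> I \<or> b \<in> I \<or> c \<in> I \<longrightarrow> tprod T a \<alpha> b \<beta> c \<in> I)"

definition tg_prime :: "('a, 'g, 'm) ternary_gamma_scheme \<Rightarrow> 'a set \<Rightarrow> bool" where
  "tg_prime T P \<longleftrightarrow> tg_ideal T P \<and> P \<noteq> carrier T \<and>
     (\<forall>a\<in>carrier T. \<forall>b\<in>carrier T. \<forall>c\<in>carrier T. \<forall>\<alpha>\<in>params T. \<forall>\<beta>\<in>params T.
        tprod T a \<alpha> b \<beta> c \<in> P \<longrightarrow> a \<in> P \<or> b \<in> P \<or> c \<in> P)"

definition tg_semiprime :: "('a, 'g, 'm) ternary_gamma_scheme \<Rightarrow> 'a set \<Rightarrow> bool" where
  "tg_semiprime T Q \<longleftrightarrow> tg_ideal T Q \<and> Q \<noteq> carrier T \<and>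
     (\<forall>a\<in>carrier T. \<forall>\<alpha>\<in>params T. \<forall>\<beta>\<in>params T. tprod T a \<alpha> a \<beta> a \<in> Q \<longrightarrow> a \<in> Q)"

text \<open>The intersection is taken inside the carrier, so an ideal contained in no prime ideal (for
  instance the whole semiring) has the whole semiring as its radical.\<close>

definition tg_radical :: "('a, 'g, 'm) ternary_gamma_scheme \<Rightarrow> 'a set \<Rightarrow> 'a set" where
  "tg_radical T I = carrier T \<inter> \<Inter>{P. tg_prime T P \<and> I \<subseteq> P}"

definition ideal_lattice :: "('a, 'g, 'm) ternary_gamma_scheme \<Rightarrow> 'a set gorder" where
  "ideal_lattice T = \<lparr>carrier = {I. tg_ideal T I}, eq = (=), le = (\<subseteq>)\<rparr>"

definition closure_operator :: "('a, 'b) gorder_scheme \<Rightarrow> ('a \<Rightarrow> 'a) \<Rightarrow> bool" where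
  "closure_operator L f \<longleftrightarrow> f \<in> carrier L \<rightarrow> carrier L \<and> (\<forall>x\<in>carrier L. x \<sqsubseteq>\<^bsub>L\<^esub> f x) \<and>
     isotone L L f \<and> idempotent L f"

lemma (in ternary_gamma_semiring) zero_in_ideal:
  assumes "tg_ideal T I" and "params T \<noteq> {}"
  shows "\<zero> \<in> I"
proof -
  interpret add: comm_monoid "\<lparr>carrier = carrier T, mult = tplus T, one = tzero T\<rparr>"
    by (rule tplus_comm_monoid)
  have z: "\<zero> \<in> carrier T" using add.one_closed by simp
  obtain x \<alpha> where x: "x \<in> I" "x \<in> carrier T" and \<alpha>: "\<alpha> \<in> params T"
    using assms unfolding tg_ideal_def by blast
  have "tprod T x \<alpha> \<zero> \<alpha> \<zero> \<in> I" using assms(1) x \<alpha> z unfolding tg_ideal_def by blast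
  then show ?thesis using tprod_zero_mid[OF x(2) z \<alpha> \<alpha>] by simp
qed

text \<open>Without parameters every additively closed nonempty subset is an ideal, and two such subsets
  may be disjoint, so the ideals need not form a lattice.\<close>

lemma (in ternary_gamma_semiring) ideal_lattice_complete:
  assumes "params T \<noteq> {}"
  shows "complete_lattice (ideal_lattice T)"
proof -
  interpret add: comm_monoid "\<lparr>carrier = carrier T, mult = tplus T, one = tzero T\<rparr>"
    by (rule tplus_comm_monoid)
  have po: "partial_order (ideal_lattice T)"
    by unfold_locales (auto simp: ideal_lattice_def)
  have car: "tg_ideal T (carrier T)"
    using add.one_closed add.m_closed tprod_closed by (auto simp: tg_ideal_def)
  show ?thesis
  proof (rule partial_order.complete_lattice_criterion1[OF po])
    show "\<exists>g. greatest (ideal_lattice T) g (carrier (ideal_lattice T))"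
      using car by (intro exI[of _ "carrier T"]) (auto simp: greatest_def ideal_lattice_def tg_ideal_def)
  next
    fix A assume A: "A \<subseteq> carrier (ideal_lattice T)" "A \<noteq> {}"
    then have A': "\<And>I. I \<in> A \<Longrightarrow> tg_ideal T I" by (auto simp: ideal_lattice_def)
    have "\<zero> \<in> \<Inter>A" using zero_in_ideal[OF A' assms] by blast
    then have "tg_ideal T (\<Inter>A)"
      using A' A(2) unfolding tg_ideal_def by (intro conjI) blast+
    then have "greatest (ideal_lattice T) (\<Inter>A) (Lower (ideal_lattice T) A)"
      using A by (auto simp: greatest_def Lower_def ideal_lattice_def)
    then show "\<exists>i. greatest (ideal_lattice T) i (Lower (ideal_lattice T) A)" ..
  qed
qed

end

theory Submission
  imports Defs
begin

text \<open>The only substantial point is that a semiprime ideal \<open>Q\<close> not containing \<open>a\<close> lies in a prime ideal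
  not containing \<open>a\<close>. Take an ideal \<open>P\<close> maximal among the semiprime ideals that contain \<open>Q\<close> and avoid
  \<open>a\<close>. The colon sets \<open>(P : y, z)\<close>, for fixed parameters, are again closed under taking cube roots, so
  a product \<open>xyz\<close> in \<open>P\<close> of three elements outside \<open>P\<close> would, by maximality applied to
  \<open>(P : y, z)\<close>, \<open>(P : a, z)\<close> and \<open>(P : a, a)\<close>, put \<open>ayz\<close>, \<open>aaz\<close> and \<open>aaa\<close> into \<open>P\<close>.\<close>

section \<open>Ideals and semiprime ideals\<close>

lemma tg_ideal_subset: "tg_ideal T I \<Longrightarrow> I \<subseteq> carrier T"
  by (simp add: tg_ideal_def)

lemma tg_ideal_plus: "\<lbrakk>tg_ideal T I; x \<in> I; y \<in> I\<rbrakk> \<Longrightarrow> tplus T x y \<in> I"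
  by (simp add: tg_ideal_def)

lemma tg_ideal_prod:
  assumes "tg_ideal T I" "a \<in> carrier T" "b \<in> carrier T" "c \<in> carrier T"
    "\<alpha> \<in> params T" "\<beta> \<in> params T" "a \<in> I \<or> b \<in> I \<or> c \<in> I"
  shows "tprod T a \<alpha> b \<beta> c \<in> I"
  using assms unfolding tg_ideal_def by blast

lemma tg_semiprimeD:
  assumes "tg_semiprime T Q" "a \<in> carrier T" "\<alpha> \<in> params T" "\<beta> \<in> params T"
    "tprod T a \<alpha> a \<beta> a \<in> Q"
  shows "a \<in> Q"
  using assms unfolding tg_semiprime_def by blast

lemma tg_prime_imp_semiprime: "tg_prime T P \<Longrightarrow> tg_semiprime T P"
  unfolding tg_prime_def tg_semiprime_def by blast

section \<open>The radical as a closure operator\<close>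

lemma tg_radical_superset: "tg_ideal T I \<Longrightarrow> I \<subseteq> tg_radical T I"
  by (auto simp: tg_radical_def tg_ideal_def)

lemma tg_radical_mono: "I \<subseteq> J \<Longrightarrow> tg_radical T I \<subseteq> tg_radical T J"
  by (auto simp: tg_radical_def)

text \<open>A prime ideal contains \<open>I\<close> exactly when it contains
  \<open>tg_radical T I\<close>, so both intersections run over the same family.\<close>

lemma tg_radical_idem: "tg_ideal T I \<Longrightarrow> tg_radical T (tg_radical T I) = tg_radical T I"
  by (auto simp: tg_radical_def tg_ideal_def)

context ternary_gamma_semiring
begin

lemma tplus_closed: "\<lbrakk>a \<in> carrier T; b \<in> carrier T\<rbrakk> \<Longrightarrow> a \<boxplus> b \<in> carrier T"
  using comm_monoid.axioms(1)[OF tplus_comm_monoid, THEN monoid.m_closed] by simp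

lemma tzero_closed: "\<zero> \<in> carrier T"
  using comm_monoid.axioms(1)[OF tplus_comm_monoid, THEN monoid.one_closed] by simp

lemma tg_ideal_carrier: "tg_ideal T (carrier T)"
  using tzero_closed tplus_closed tprod_closed by (auto simp: tg_ideal_def)

lemma tg_radical_ideal:
  assumes "tg_ideal T I"
  shows "tg_ideal T (tg_radical T I)"
  unfolding tg_ideal_def
proof (intro conjI ballI impI)
  show "tg_radical T I \<noteq> {}"
    using tg_radical_superset[OF assms] assms by (auto simp: tg_ideal_def)
  show "tg_radical T I \<subseteq> carrier T" by (simp add: tg_radical_def)
next
  fix x y assume "x \<in> tg_radical T I" "y \<in> tg_radical T I"
  then show "x \<boxplus> y \<in> tg_radical T I"
    unfolding tg_radical_def tg_prime_def by (blast intro: tplus_closed tg_ideal_plus)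
next
  fix a b c \<alpha> \<beta>
  assume "a \<in> carrier T" "b \<in> carrier T" "c \<in> carrier T" "\<alpha> \<in> params T" "\<beta> \<in> params T"
    "a \<in> tg_radical T I \<or> b \<in> tg_radical T I \<or> c \<in> tg_radical T I"
  then show "tprod T a \<alpha> b \<beta> c \<in> tg_radical T I"
    unfolding tg_radical_def tg_prime_def by (blast intro: tprod_closed tg_ideal_prod)
qed

lemma tg_radical_carrier: "tg_radical T (carrier T) = carrier T"
  using tg_radical_superset[OF tg_ideal_carrier] by (auto simp: tg_radical_def)

text \<open>A cube in the radical lies in every prime ideal over \<open>I\<close>, hence so does its
  base. Properness has to be assumed: it fails when no prime ideal lies over
  \<open>I\<close>.\<close>

lemma tg_radical_semiprime:
  assumes "tg_ideal T I" "tg_radical T I \<noteq> carrier T"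
  shows "tg_semiprime T (tg_radical T I)"
  unfolding tg_semiprime_def
proof (intro conjI ballI impI)
  fix a \<alpha> \<beta>
  assume a: "a \<in> carrier T" "\<alpha> \<in> params T" "\<beta> \<in> params T"
    and cube: "tprod T a \<alpha> a \<beta> a \<in> tg_radical T I"
  have "a \<in> P" if "tg_prime T P" "I \<subseteq> P" for P
    using tg_semiprimeD[OF tg_prime_imp_semiprime[OF that(1)] a] cube that
    by (simp add: tg_radical_def)
  then show "a \<in> tg_radical T I" using a(1) by (simp add: tg_radical_def)
qed (use assms tg_radical_ideal in auto)

lemma tg_radical_closure: "closure_operator (ideal_lattice T) (tg_radical T)"
proof -
  \<comment> \<open>\<open>isotone\<close> includes the requirement that source and target are weak
    partial orders.\<close>
  have "weak_partial_order (ideal_lattice T)"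
    by unfold_locales (auto simp: ideal_lattice_def)
  then show ?thesis
    using tg_radical_ideal unfolding closure_operator_def isotone_def idempotent_def
    by (simp add: ideal_lattice_def tg_radical_superset tg_radical_idem tg_radical_mono)
qed

text \<open>Absorption and cube roots involve one element of the union, hence one member of the
  chain; sums use that two members are comparable. The common missing point \<open>a\<close> keeps
  the union proper.\<close>

lemma tg_semiprime_Union_chain:
  assumes "\<C> \<noteq> {}" "subset.chain {Q. tg_semiprime T Q \<and> a \<notin> Q} \<C>" "a \<in> carrier T"
  shows "tg_semiprime T (\<Union>\<C>)"
proof -
  have sp: "\<And>Q. Q \<in> \<C> \<Longrightarrow> tg_semiprime T Q" and na: "a \<notin> \<Union>\<C>"
    and ch: "\<And>Q R. Q \<in> \<C> \<Longrightarrow> R \<in> \<C> \<Longrightarrow> Q \<subseteq> R \<or> R \<subseteq> Q"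
    using assms(2) unfolding subset.chain_def by blast+
  have id: "\<And>Q. Q \<in> \<C> \<Longrightarrow> tg_ideal T Q" using sp by (simp add: tg_semiprime_def)
  have "x \<boxplus> y \<in> \<Union>\<C>" if xy: "x \<in> \<Union>\<C>" "y \<in> \<Union>\<C>" for x y
  proof -
    obtain Q R where QR: "Q \<in> \<C>" "R \<in> \<C>" "x \<in> Q" "y \<in> R" using xy by blast
    then obtain S where "S \<in> \<C>" "x \<in> S" "y \<in> S" using ch[OF QR(1,2)] by blast
    then show ?thesis using tg_ideal_plus[OF id] by blast
  qed
  moreover have "\<Union>\<C> \<noteq> {}" "\<Union>\<C> \<subseteq> carrier T"
    using assms(1) id unfolding tg_ideal_def by blast+
  moreover have "tprod T x \<alpha> y \<beta> z \<in> \<Union>\<C>"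
    if xyz: "x \<in> carrier T" "y \<in> carrier T" "z \<in> carrier T" "\<alpha> \<in> params T" "\<beta> \<in> params T"
      "x \<in> \<Union>\<C> \<or> y \<in> \<Union>\<C> \<or> z \<in> \<Union>\<C>" for x y z \<alpha> \<beta>
  proof -
    obtain Q where "Q \<in> \<C>" "x \<in> Q \<or> y \<in> Q \<or> z \<in> Q" using xyz(6) by blast
    then show ?thesis using tg_ideal_prod[OF id] xyz(1-5) by blast
  qed
  ultimately have "tg_ideal T (\<Union>\<C>)" by (simp only: tg_ideal_def) blast
  moreover have "x \<in> \<Union>\<C>"
    if "x \<in> carrier T" "\<alpha> \<in> params T" "\<beta> \<in> params T" "tprod T x \<alpha> x \<beta> x \<in> \<Union>\<C>" for x \<alpha> \<beta>
    using that sp by (blast intro: tg_semiprimeD)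
  ultimately show ?thesis
    using na assms(3) unfolding tg_semiprime_def by blast
qed

end

text \<open>The parameters are fixed and not quantified over, since primeness is a condition on a
  single product with given parameters.\<close>

definition tg_colon ::
  "('a, 'g, 'm) ternary_gamma_scheme \<Rightarrow> 'a set \<Rightarrow> 'g \<Rightarrow> 'a \<Rightarrow> 'g \<Rightarrow> 'a \<Rightarrow> 'a set" where
  "tg_colon T P \<alpha> y \<beta> z = {u \<in> carrier T. tprod T u \<alpha> y \<beta> z \<in> P}"

section \<open>Consequences of commutativity\<close>

context comm_ternary_gamma_semiring
begin

text \<open>One commutativity axiom carries the parameters along with the factors, the other leaves
  them in place. Applying the first, the second and again the first restores the parameter
  order.\<close>

lemma tprod_swap_23:
  assumes "a \<in> carrier T" "b \<in> carrier T" "c \<in> carrier T" "\<alpha> \<in> params T" "\<beta> \<in> params T"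
  shows "tprod T a \<alpha> b \<beta> c = tprod T a \<alpha> c \<beta> b"
  using assms by (metis tprod_comm_12 tprod_comm_13)

lemma tprod_swap_12:
  assumes "a \<in> carrier T" "b \<in> carrier T" "c \<in> carrier T" "\<alpha> \<in> params T" "\<beta> \<in> params T"
  shows "tprod T a \<alpha> b \<beta> c = tprod T b \<alpha> a \<beta> c"
  using assms by (metis tprod_swap_23 tprod_comm_13)

text \<open>Any two translations in the first variable commute: flip the inner product so that
  \<open>u\<close> comes last, reassociate, and flip back.\<close>

lemma tprod_exchange:
  assumes "u \<in> carrier T" "y \<in> carrier T" "z \<in> carrier T" "b \<in> carrier T" "c \<in> carrier T"
    "\<alpha> \<in> params T" "\<beta> \<in> params T" "\<gamma> \<in> params T" "\<delta> \<in> params T"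
  shows "tprod T (tprod T u \<alpha> y \<beta> z) \<gamma> b \<delta> c = tprod T (tprod T u \<gamma> b \<delta> c) \<alpha> y \<beta> z"
proof -
  have "tprod T (tprod T u \<alpha> y \<beta> z) \<gamma> b \<delta> c = tprod T (tprod T z \<alpha> y \<beta> u) \<gamma> b \<delta> c"
    using assms by (simp add: tprod_comm_13[of u])
  also have "\<dots> = tprod T z \<alpha> y \<beta> (tprod T u \<gamma> b \<delta> c)"
    using assms by (simp add: tprod_assoc)
  also have "\<dots> = tprod T (tprod T u \<gamma> b \<delta> c) \<alpha> y \<beta> z"
    using assms by (simp add: tprod_comm_13 tprod_closed)
  finally show ?thesis .
qed

text \<open>By the exchange law a translation \<open>f\<close> can be pulled out of the first slot
  of a product. Permuting the factors brings each of the three copies of \<open>f u\<close> there in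
  turn.\<close>

lemma tprod_cube:
  assumes "u \<in> carrier T" "y \<in> carrier T" "z \<in> carrier T"
    "\<alpha> \<in> params T" "\<beta> \<in> params T" "\<gamma> \<in> params T" "\<delta> \<in> params T"
  defines "f \<equiv> \<lambda>u. tprod T u \<alpha> y \<beta> z"
  shows "tprod T (f u) \<gamma> (f u) \<delta> (f u) = f (f (f (tprod T u \<gamma> u \<delta> u)))"
proof -
  have f: "f x \<in> carrier T" if "x \<in> carrier T" for x
    using that assms by (simp add: f_def tprod_closed)
  have ex: "tprod T (f x) \<gamma> b \<delta> c = f (tprod T x \<gamma> b \<delta> c)"
    if "x \<in> carrier T" "b \<in> carrier T" "c \<in> carrier T" for x b c
    using that assms by (simp add: f_def tprod_exchange)
  have "tprod T (f u) \<gamma> (f u) \<delta> (f u) = f (tprod T u \<gamma> (f u) \<delta> (f u))"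
    using assms(1) f ex by simp
  also have "tprod T u \<gamma> (f u) \<delta> (f u) = tprod T (f u) \<gamma> u \<delta> (f u)"
    using assms(1-7) f by (intro tprod_swap_12) auto
  also have "\<dots> = f (tprod T u \<gamma> u \<delta> (f u))"
    using assms(1) f ex by simp
  also have "tprod T u \<gamma> u \<delta> (f u) = tprod T (f u) \<gamma> u \<delta> u"
    using assms(1-7) f by (intro tprod_comm_13) auto
  also have "\<dots> = f (tprod T u \<gamma> u \<delta> u)"
    using assms(1) ex by simp
  finally show ?thesis .
qed

section \<open>Colon ideals\<close>

lemma tg_colon_superset:
  assumes "tg_ideal T P" "y \<in> carrier T" "z \<in> carrier T" "\<alpha> \<in> params T" "\<beta> \<in> params T"
  shows "P \<subseteq> tg_colon T P \<alpha> y \<beta> z"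
  using assms tg_ideal_subset[OF assms(1)] by (auto simp: tg_colon_def intro!: tg_ideal_prod)

lemma tg_colon_ideal:
  assumes P: "tg_ideal T P" and yz: "y \<in> carrier T" "z \<in> carrier T" "\<alpha> \<in> params T" "\<beta> \<in> params T"
  shows "tg_ideal T (tg_colon T P \<alpha> y \<beta> z)"
proof -
  \<comment> \<open>Only the first slot is treated by the exchange law; the other two reduce to it
    by permuting factors.\<close>
  have left: "tprod T u \<gamma> b \<delta> c \<in> tg_colon T P \<alpha> y \<beta> z"
    if "u \<in> tg_colon T P \<alpha> y \<beta> z" "b \<in> carrier T" "c \<in> carrier T" "\<gamma> \<in> params T" "\<delta> \<in> params T"
    for u b c \<gamma> \<delta>
  proof -
    have u: "u \<in> carrier T" "tprod T u \<alpha> y \<beta> z \<in> P"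
      using that by (auto simp: tg_colon_def)
    have "tprod T (tprod T u \<alpha> y \<beta> z) \<gamma> b \<delta> c \<in> P"
      using u that yz P by (blast intro: tg_ideal_prod tprod_closed)
    moreover have "tprod T (tprod T u \<alpha> y \<beta> z) \<gamma> b \<delta> c = tprod T (tprod T u \<gamma> b \<delta> c) \<alpha> y \<beta> z"
      using u(1) that(2-) yz by (intro tprod_exchange)
    ultimately show ?thesis
      using u(1) that(2-) by (simp add: tg_colon_def tprod_closed)
  qed
  have "tprod T a \<gamma> b \<delta> c \<in> tg_colon T P \<alpha> y \<beta> z"
    if abc: "a \<in> carrier T" "b \<in> carrier T" "c \<in> carrier T" "\<gamma> \<in> params T" "\<delta> \<in> params T"
      and "a \<in> tg_colon T P \<alpha> y \<beta> z \<or> b \<in> tg_colon T P \<alpha> y \<beta> z \<or> c \<in> tg_colon T P \<alpha> y \<beta> z"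
    for a b c \<gamma> \<delta>
    using that(6) left abc tprod_swap_12[OF abc] tprod_comm_13[OF abc] by metis
  moreover have "tg_colon T P \<alpha> y \<beta> z \<noteq> {}"
    using tg_colon_superset[OF assms] P by (auto simp: tg_ideal_def)
  moreover have "u \<boxplus> v \<in> tg_colon T P \<alpha> y \<beta> z"
    if "u \<in> tg_colon T P \<alpha> y \<beta> z" "v \<in> tg_colon T P \<alpha> y \<beta> z" for u v
    using that yz P by (auto simp: tg_colon_def tprod_add_left intro: tplus_closed tg_ideal_plus)
  ultimately show ?thesis
    unfolding tg_ideal_def by (auto simp: tg_colon_def)
qed

text \<open>Let \<open>f\<close> be the translation by \<open>y\<close> and \<open>z\<close>. If
  \<open>f\<close> sends the cube of \<open>u\<close> into \<open>P\<close>, then the cube of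
  \<open>f u\<close>, being \<open>f\<close> applied three times to the cube of \<open>u\<close>, is
  in \<open>P\<close> as well, and so is \<open>f u\<close>.\<close>

lemma tg_colon_semiprime:
  assumes P: "tg_semiprime T P"
    and yz: "y \<in> carrier T" "z \<in> carrier T" "\<alpha> \<in> params T" "\<beta> \<in> params T"
    and proper: "tg_colon T P \<alpha> y \<beta> z \<noteq> carrier T"
  shows "tg_semiprime T (tg_colon T P \<alpha> y \<beta> z)"
  unfolding tg_semiprime_def
proof (intro conjI ballI impI)
  have id: "tg_ideal T P" using P by (simp add: tg_semiprime_def)
  then show "tg_ideal T (tg_colon T P \<alpha> y \<beta> z)" using yz by (rule tg_colon_ideal)
  fix u \<gamma> \<delta>
  assume u: "u \<in> carrier T" "\<gamma> \<in> params T" "\<delta> \<in> params T"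
    and "tprod T u \<gamma> u \<delta> u \<in> tg_colon T P \<alpha> y \<beta> z"
  then have v: "tprod T (tprod T u \<gamma> u \<delta> u) \<alpha> y \<beta> z \<in> P"
    by (simp add: tg_colon_def)
  \<comment> \<open>This absorbs the two outer applications of the translation in
    \<open>tprod_cube\<close>.\<close>
  have mult: "tprod T x \<alpha> y \<beta> z \<in> P" if "x \<in> P" for x
    using tg_colon_superset[OF id yz] that by (auto simp: tg_colon_def)
  have "tprod T (tprod T u \<alpha> y \<beta> z) \<gamma> (tprod T u \<alpha> y \<beta> z) \<delta> (tprod T u \<alpha> y \<beta> z) \<in> P"
    using tprod_cube[of u y z \<alpha> \<beta> \<gamma> \<delta>] u yz v mult by simp
  then have "tprod T u \<alpha> y \<beta> z \<in> P"
    using tg_semiprimeD[OF P] u yz by (blast intro: tprod_closed)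
  then show "u \<in> tg_colon T P \<alpha> y \<beta> z" using u by (simp add: tg_colon_def)
qed (fact proper)

section \<open>Separation of a point from a semiprime ideal by a prime ideal\<close>

lemma prime_avoiding:
  assumes Q: "tg_semiprime T Q" and a: "a \<in> carrier T" "a \<notin> Q"
  obtains P where "tg_prime T P" "Q \<subseteq> P" "a \<notin> P"
proof -
  \<comment> \<open>Maximality is taken among semiprime ideals only; this suffices because the
    ideals compared with the maximal one are colon ideals, which inherit semiprimeness.\<close>
  define \<A> where "\<A> = {R. tg_semiprime T R \<and> a \<notin> R \<and> Q \<subseteq> R}"
  have "\<exists>M\<in>\<A>. \<forall>X\<in>\<A>. M \<subseteq> X \<longrightarrow> X = M"
  proof (rule subset_Zorn_nonempty)
    show "\<A> \<noteq> {}" using Q a by (auto simp: \<A>_def)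
    fix \<C> assume C: "\<C> \<noteq> {}" "subset.chain \<A> \<C>"
    then have "subset.chain {R. tg_semiprime T R \<and> a \<notin> R} \<C>"
      unfolding subset.chain_def \<A>_def by blast
    then have "tg_semiprime T (\<Union>\<C>)"
      using tg_semiprime_Union_chain C(1) a(1) by blast
    moreover have "a \<notin> \<Union>\<C>" "Q \<subseteq> \<Union>\<C>"
      using C unfolding subset.chain_def \<A>_def by blast+
    ultimately show "\<Union>\<C> \<in> \<A>" by (simp add: \<A>_def)
  qed
  then obtain P where PA: "P \<in> \<A>" and Pmax: "\<And>X. X \<in> \<A> \<Longrightarrow> P \<subseteq> X \<Longrightarrow> X = P"
    by metis
  then have sp: "tg_semiprime T P" and aP: "a \<notin> P" and QP: "Q \<subseteq> P"
    by (simp_all add: \<A>_def)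
  have max: "R = P" if "tg_semiprime T R" "a \<notin> R" "P \<subseteq> R" for R
    using Pmax[of R] that QP by (simp add: \<A>_def)
  have id: "tg_ideal T P" using sp by (simp add: tg_semiprime_def)
  \<comment> \<open>The colon ideal contains \<open>x\<close> and is thus strictly larger than
    \<open>P\<close>, so by maximality it must contain \<open>a\<close>.\<close>
  have replace: "tprod T a \<alpha> y \<beta> z \<in> P"
    if "tprod T x \<alpha> y \<beta> z \<in> P" "x \<in> carrier T" "x \<notin> P"
      "y \<in> carrier T" "z \<in> carrier T" "\<alpha> \<in> params T" "\<beta> \<in> params T" for x y z \<alpha> \<beta>
  proof (rule ccontr)
    assume "tprod T a \<alpha> y \<beta> z \<notin> P"
    then have na: "a \<notin> tg_colon T P \<alpha> y \<beta> z" by (simp add: tg_colon_def)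
    \<comment> \<open>Missing the point \<open>a\<close> also makes the colon ideal proper.\<close>
    then have "tg_semiprime T (tg_colon T P \<alpha> y \<beta> z)"
      using tg_colon_semiprime[OF sp] that a(1) by blast
    then have "tg_colon T P \<alpha> y \<beta> z = P"
      using max na tg_colon_superset[OF id] that by blast
    then show False using that by (auto simp: tg_colon_def)
  qed
  have "x \<in> P \<or> y \<in> P \<or> z \<in> P"
    if xyz: "x \<in> carrier T" "y \<in> carrier T" "z \<in> carrier T" and p: "\<alpha> \<in> params T" "\<beta> \<in> params T"
      and prod: "tprod T x \<alpha> y \<beta> z \<in> P" for x y z \<alpha> \<beta>
  proof (rule ccontr)
    assume n: "\<not> (x \<in> P \<or> y \<in> P \<or> z \<in> P)"
    \<comment> \<open>The factors \<open>x\<close>, \<open>y\<close>, \<open>z\<close> are exchanged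
      for \<open>a\<close> one after another, each being moved to the first slot beforehand. The
      cube of \<open>a\<close> then contradicts semiprimeness of \<open>P\<close>.\<close>
    have "tprod T a \<alpha> y \<beta> z \<in> P" using replace prod xyz p n by blast
    then have "tprod T y \<alpha> a \<beta> z \<in> P" using tprod_swap_12 xyz a(1) p by simp
    then have "tprod T a \<alpha> a \<beta> z \<in> P" using replace xyz a(1) p n by blast
    then have "tprod T z \<alpha> a \<beta> a \<in> P" using tprod_comm_13 xyz a(1) p by simp
    then have "tprod T a \<alpha> a \<beta> a \<in> P" using replace xyz a(1) p n by blast
    then show False using tg_semiprimeD[OF sp] a(1) p aP by blast
  qed
  then have "tg_prime T P" using sp unfolding tg_prime_def tg_semiprime_def by blast
  then show thesis using that QP aP by blast
qed

lemma tg_radical_of_semiprime: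
  assumes "tg_semiprime T Q"
  shows "tg_radical T Q = Q"
proof
  show "tg_radical T Q \<subseteq> Q"
    unfolding tg_radical_def using prime_avoiding[OF assms] by blast
  show "Q \<subseteq> tg_radical T Q"
    using assms by (intro tg_radical_superset) (simp add: tg_semiprime_def)
qed

text \<open>The whole semiring is listed separately: semiprime ideals are proper by definition,
  while no prime ideal contains \<open>carrier T\<close>, so its radical is \<open>carrier T\<close>
  again.\<close>

lemma fps_tg_radical:
  "fps (ideal_lattice T) (tg_radical T) = {Q. tg_semiprime T Q} \<union> {carrier T}"
proof -
  have "fps (ideal_lattice T) (tg_radical T) = {I. tg_ideal T I \<and> tg_radical T I = I}"
    by (auto simp: fps_def ideal_lattice_def)
  also have "\<dots> = {Q. tg_semiprime T Q} \<union> {carrier T}"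
  proof (intro equalityI subsetI)
    fix I assume "I \<in> {I. tg_ideal T I \<and> tg_radical T I = I}"
    then show "I \<in> {Q. tg_semiprime T Q} \<union> {carrier T}"
      using tg_radical_semiprime[of I] by auto
  next
    fix I assume "I \<in> {Q. tg_semiprime T Q} \<union> {carrier T}"
    then consider "tg_semiprime T I" | "I = carrier T" by blast
    then show "I \<in> {I. tg_ideal T I \<and> tg_radical T I = I}"
    proof cases
      case 1
      then have "tg_ideal T I" by (simp add: tg_semiprime_def)
      then show ?thesis using tg_radical_of_semiprime[OF 1] by simp
    next
      case 2
      then show ?thesis by (simp add: tg_ideal_carrier tg_radical_carrier)
    qed
  qed
  finally show ?thesis .
qed

end

theorem corollary5p8:
  fixes T :: "('a, 'g) ternary_gamma"
  assumes "comm_ternary_gamma_semiring T"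
  shows "closure_operator (ideal_lattice T) (tg_radical T) \<and>
    fps (ideal_lattice T) (tg_radical T) = {Q. tg_semiprime T Q} \<union> {carrier T}"
proof -
  interpret comm_ternary_gamma_semiring T by (fact assms)
  show ?thesis using tg_radical_closure fps_tg_radical by blast
qed

end
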